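(* For every integer $m\ge 0$, $$\sum_{k=1}^\infty (\zeta(2k)-1) F_{2k+m-1} = \frac{\pi}{2\sqrt{5}}\tan\!\Big(\frac{\sqrt{5}\,\pi}{2}\Big)L_{m} + \frac{1}{2}F_{m+2}$$ and $$\sum_{k=1}^\infty (\zeta(2k)-1) L_{2k+m-1} = \frac{\sqrt{5}\,\pi}{2}\tan\!\Big(\frac{\sqrt{5}\,\pi}{2}\Big)F_{m} + \frac{1}{2}L_{m+2}.$$
   Context: $\zeta$ is the Riemann zeta function, $\zeta(s)=\sum_{n\ge1} n^{-s}$ for $\Re(s)>1$. The Fibonacci numbers $F_n$ and Lucas numbers $L_n$ are defined by $F_0=0$, $F_1=1$, $L_0=2$, $L_1=1$, $F_{n+2}=F_{n+1}+F_n$, $L_{n+2}=L_{n+1}+L_n$. *)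

theory Defs
  imports "HOL-Analysis.Analysis" "HOL-Number_Theory.Fib"
begin

text \<open>
  The Riemann zeta function on the half-plane of absolute convergence \<open>Re s > 1\<close>, given by its
  Dirichlet series (the index is shifted so that summation starts at \<open>n = 1\<close>). The analytic
  continuation is not modelled: the value is meaningful only for \<open>Re s > 1\<close>.
\<close>

definition zeta :: "complex \<Rightarrow> complex"
  where "zeta s = (\<Sum>n. of_nat (Suc n) powr (- s))"

fun lucas_number :: "nat \<Rightarrow> nat"
  where
    "lucas_number 0 = 2"
  | "lucas_number (Suc 0) = 1"
  | "lucas_number (Suc (Suc n)) = lucas_number (Suc n) + lucas_number n"

end

theory Submission
  imports Defs
begin

text \<open>
  Expanding \<open>\<zeta>(2k) - 1 = \<Sum>\<^sub>n\<^sub>\<ge>\<^sub>2 n\<^sup>-\<^sup>2\<^sup>k\<close> and summing the geometric series in \<open>k\<close> first turns the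
  generating function of these numbers into a tail of the partial fraction expansion of the
  cotangent: for \<open>|z| < 2\<close> not an integer,
  \<open>\<Sum>\<^sub>k\<^sub>\<ge>\<^sub>1 (\<zeta>(2k) - 1) z\<^sup>2\<^sup>k\<^sup>-\<^sup>1 = \<Sum>\<^sub>n\<^sub>\<ge>\<^sub>2 z / (n\<^sup>2 - z\<^sup>2)
    = 1 / (2z) - (\<pi>/2) cot (\<pi>z) - z / (1 - z\<^sup>2)\<close>
  (\<open>even_zeta_generating_function\<close>). Removing the term \<open>n = 1\<close> is what enlarges the radius of
  convergence from 1 to 2, so that the golden ratio \<open>\<phi>\<close> is admissible.

  At a root \<open>x\<close> of \<open>x\<^sup>2 = x + 1\<close> the rational part of the right-hand side collapses to \<open>x\<^sup>2 / 2\<close>, so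
  multiplying by \<open>x\<^sup>m\<close> gives \<open>x\<^sup>m\<^sup>+\<^sup>2 / 2 - (\<pi>/2) cot (\<pi>x) x\<^sup>m\<close> (\<open>even_zeta_series_golden\<close>). The two
  roots are \<open>(1 \<plusminus> \<surd>5) / 2\<close>, and the shift by \<open>1/2\<close> makes the cotangent equal to
  \<open>\<minusplus>tan (\<surd>5 \<pi> / 2)\<close>. By Binet's formulas, subtracting the two series and dividing by \<open>\<surd>5\<close> yields
  the Fibonacci identity, adding them the Lucas identity. Since the two cotangents have opposite
  signs, the coefficient of the tangent is a Lucas number in the former and a Fibonacci number in
  the latter.
\<close>

section \<open>The partial fractions of the cotangent\<close>

text \<open>
  This is the logarithmic derivative of Euler's reflection formula. Working with the reciprocal
  Gamma function \<open>1/\<Gamma>\<close>, the formula reads \<open>1 / (\<Gamma>(z) \<Gamma>(1 - z)) = sin (\<pi>z) / \<pi>\<close>; both sides are entire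
  and can be differentiated without choosing a branch of the logarithm.
\<close>
lemma Digamma_reflection:
  fixes z :: complex
  assumes "z \<notin> \<int>"
  shows "Digamma (1 - z) - Digamma z = of_real pi * cot (of_real pi * z)"
proof -
  have z: "z \<notin> \<int>\<^sub>\<le>\<^sub>0" "1 - z \<notin> \<int>\<^sub>\<le>\<^sub>0"
    using assms nonpos_Ints_subset_Ints[where 'a = complex] by (auto dest: Ints_diff[OF Ints_1])
  have "((\<lambda>w. rGamma w * rGamma (1 - w)) has_field_derivative
          rGamma z * rGamma (1 - z) * (Digamma (1 - z) - Digamma z)) (at z)"
  proof -
    have "((\<lambda>w. rGamma (1 - w)) has_field_derivative
             -rGamma (1 - z) * Digamma (1 - z) * (-1)) (at z)"
    proof (rule DERIV_chain2[where f = rGamma and g = "\<lambda>w. 1 - w"])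
      show "(rGamma has_field_derivative -rGamma (1 - z) * Digamma (1 - z)) (at (1 - z))"
        by (rule has_field_derivative_rGamma_no_nonpos_int[OF z(2)])
      show "((\<lambda>w. 1 - w) has_field_derivative -1) (at z)"
        by (auto intro!: derivative_eq_intros)
    qed
    from DERIV_mult[OF has_field_derivative_rGamma_no_nonpos_int[OF z(1)] this]
    show ?thesis by (simp add: algebra_simps)
  qed
  moreover have "(\<lambda>w. rGamma w * rGamma (1 - w)) = (\<lambda>w::complex. sin (of_real pi * w) / of_real pi)"
    by (simp add: fun_eq_iff rGamma_reflection_complex)
  moreover have "((\<lambda>w::complex. sin (of_real pi * w) / of_real pi) has_field_derivative
      cos (of_real pi * z)) (at z)"
    by (auto intro!: derivative_eq_intros)
  ultimately have "sin (of_real pi * z) / of_real pi * (Digamma (1 - z) - Digamma z) = cos (of_real pi * z)"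
    by (metis DERIV_unique rGamma_reflection_complex)
  moreover have "sin (of_real pi * z) \<noteq> 0"
    using assms by (auto simp: sin_eq_0 mult.commute)
  ultimately show ?thesis by (simp add: cot_def field_simps)
qed

text \<open>
  Splitting the summand as \<open>(1 / (n - z) - 1 / (n + z)) / 2\<close> exhibits the partial sums as
  differences of those in the limit formula
  \<open>\<psi>(w) = lim\<^sub>m (ln m - \<Sum>\<^sub>n\<^sub><\<^sub>m 1 / (w + n))\<close>, so the series sums to \<open>(\<psi>(1 + z) - \<psi>(1 - z)) / 2\<close>, which
  the functional equation and the reflection formula of the Digamma function evaluate.
\<close>
lemma cot_partial_fractions:
  fixes z :: complex
  assumes "z \<notin> \<int>"
  shows "(\<lambda>n. z / (of_nat (Suc n) ^ 2 - z ^ 2)) sums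
           (1 / (2 * z) - of_real pi / 2 * cot (of_real pi * z))"
proof -
  have z0: "z \<noteq> 0" using assms by auto
  \<comment> \<open>No denominator vanishes, since \<open>z\<close> is not an integer.\<close>
  have nz: "of_nat (Suc n) - z \<noteq> 0" "of_nat (Suc n) + z \<noteq> 0" for n
  proof -
    have "of_nat (Suc n) - z \<notin> \<int>" "of_nat (Suc n) + z \<notin> \<int>"
      using assms Ints_diff[of "of_nat (Suc n)" "of_nat (Suc n) - z"]
        Ints_diff[of "of_nat (Suc n) + z" "of_nat (Suc n)"] by auto
    thus "of_nat (Suc n) - z \<noteq> 0" "of_nat (Suc n) + z \<noteq> 0" by (metis Ints_0)+
  qed
  have term_eq: "(inverse (1 - z + of_nat n) - inverse (1 + z + of_nat n)) / 2
        = z / (of_nat (Suc n) ^ 2 - z ^ 2)" for n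
  proof -
    define a b where "a = 1 - z + of_nat n" and "b = 1 + z + of_nat n"
    have "of_nat (Suc n) ^ 2 - z ^ 2 = a * b" "z = (b - a) / 2"
      by (simp_all add: a_def b_def power2_eq_square algebra_simps)
    moreover have "a \<noteq> 0" "b \<noteq> 0"
      using nz[of n] by (simp_all add: a_def b_def algebra_simps)
    hence "(inverse a - inverse b) / 2 = (b - a) / 2 / (a * b)"
      by (simp add: field_simps)
    ultimately show ?thesis unfolding a_def b_def by metis
  qed
  have ne: "1 - z \<noteq> 0" "1 + z \<noteq> 0" using nz[of 0] by simp_all
  have "(\<lambda>m. (\<Sum>n<m. inverse (1 - z + of_nat n)) - (\<Sum>n<m. inverse (1 + z + of_nat n)))
          \<longlonglongrightarrow> Digamma (1 + z) - Digamma (1 - z)"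
    using tendsto_diff[OF Digamma_LIMSEQ[OF ne(2)] Digamma_LIMSEQ[OF ne(1)]] by simp
  hence "(\<lambda>n. inverse (1 - z + of_nat n) - inverse (1 + z + of_nat n)) sums
           (Digamma (1 + z) - Digamma (1 - z))"
    by (simp only: sums_def sum_subtractf)
  from sums_divide[OF this, of 2]
  have "(\<lambda>n. z / (of_nat (Suc n) ^ 2 - z ^ 2)) sums ((Digamma (1 + z) - Digamma (1 - z)) / 2)"
    by (simp only: term_eq)
  moreover have "Digamma (1 + z) = Digamma z + 1 / z"
    using Digamma_plus1[OF z0] by (simp add: add.commute)
  ultimately show ?thesis
    using Digamma_reflection[OF assms] z0 by (simp add: field_simps)
qed

section \<open>The generating function of the even zeta values\<close>

text \<open>
  The unordered form of the Dirichlet series without its first term, as needed for exchanging the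
  order of summation below.
\<close>
lemma zeta_nat_minus_1_has_sum:
  assumes "s \<ge> 2"
  shows "((\<lambda>n. inverse (of_nat (n + 2) ^ s)) has_sum (zeta (of_nat s) - 1)) UNIV"
proof -
  have term_eq: "of_nat (Suc n) powr (- of_nat s) = inverse (of_nat (Suc n) ^ s :: complex)" for n
    by (simp add: powr_minus powr_nat' del: of_nat_Suc)
  have "summable (\<lambda>n. inverse (of_nat (Suc n) ^ s :: complex))"
    using inverse_power_summable[OF assms] by (subst summable_Suc_iff)
  hence "(\<lambda>n. inverse (of_nat (Suc n) ^ s)) sums zeta (of_nat s)"
    unfolding zeta_def term_eq by (rule summable_sums)
  hence "(\<lambda>n. inverse (of_nat (n + 2) ^ s)) sums (zeta (of_nat s) - 1)"
    using sums_Suc_iff[of "\<lambda>n. inverse (of_nat (Suc n) ^ s)" "zeta (of_nat s) - 1"] by simp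
  moreover have "summable (\<lambda>n. norm (inverse (of_nat (n + 2) ^ s :: complex)))"
    using summable_ignore_initial_segment[OF inverse_power_summable[OF assms, where 'a = real], of 2]
    by (simp only: norm_inverse norm_power norm_of_nat)
  ultimately show ?thesis
    by (intro norm_summable_imp_has_sum)
qed

text \<open>
  As \<open>n + 2 \<ge> 2\<close>, the norm of the \<open>(k, n)\<close> term is at most \<open>q\<^sup>k |z| / (n + 2)\<^sup>2\<close> with \<open>q = (|z| / 2)\<^sup>2 < 1\<close>:
  a geometric series times a convergent \<open>p\<close>-series.
\<close>
lemma even_zeta_double_series_summable:
  fixes z :: complex
  assumes "norm z < 2"
  shows "(\<lambda>(k, n). z ^ (2 * k + 1) / of_nat (n + 2) ^ (2 * Suc k)) summable_on (UNIV \<times> UNIV)"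
proof -
  define q where "q = (norm z / 2)\<^sup>2"
  have q: "0 \<le> q" "q < 1"
    using assms by (auto simp: q_def abs_square_less_1)
  have "summable (\<lambda>n. inverse (real (n + 2) ^ 2))"
    using summable_ignore_initial_segment[OF inverse_power_summable[of 2, where 'a = real], of 2]
    by simp
  hence "(\<lambda>n. inverse (real (n + 2) ^ 2)) summable_on UNIV"
    by (subst summable_on_UNIV_nonneg_real_iff) auto
  hence g: "(\<lambda>k. q ^ k * (norm z * (\<Sum>\<^sub>\<infinity>n. inverse (real (n + 2) ^ 2)))) summable_on UNIV" and
    f: "((\<lambda>n. q ^ k * (norm z * inverse (real (n + 2) ^ 2))) has_sum
        (q ^ k * (norm z * (\<Sum>\<^sub>\<infinity>n. inverse (real (n + 2) ^ 2))))) UNIV" for k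
    using q by (auto intro!: summable_on_cmult_left has_sum_cmult_right has_sum_infsum
                  summable_nonneg_imp_summable_on summable_geometric)
  have "(\<lambda>(k, n). q ^ k * (norm z * inverse (real (n + 2) ^ 2))) summable_on (UNIV \<times> UNIV)"
    using f g q(1)
    by (intro summable_on_SigmaI[where
          g = "\<lambda>k. q ^ k * (norm z * (\<Sum>\<^sub>\<infinity>n. inverse (real (n + 2) ^ 2)))"]) auto
  hence "(\<lambda>p. norm (case p of (k, n) \<Rightarrow> z ^ (2 * k + 1) / of_nat (n + 2) ^ (2 * Suc k)))
            summable_on (UNIV \<times> UNIV)"
  proof (rule Infinite_Sum.abs_summable_on_comparison_test', goal_cases)
    case (1 p)
    obtain k n where p: "p = (k, n)" by force
    have "norm (z ^ (2 * k + 1) / of_nat (n + 2) ^ (2 * Suc k))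
        = norm z / real (n + 2) ^ 2 * ((norm z) ^ (2 * k) / real (n + 2) ^ (2 * k))"
      by (simp only: norm_divide norm_power norm_of_nat)
         (simp add: power_add power2_eq_square)
    also have "\<dots> \<le> norm z / real (n + 2) ^ 2 * ((norm z) ^ (2 * k) / 2 ^ (2 * k))"
      by (intro mult_left_mono divide_left_mono power_mono) auto
    also have "\<dots> = q ^ k * (norm z * inverse (real (n + 2) ^ 2))"
      by (simp only: q_def power_divide power_mult) (simp add: divide_inverse)
    finally show ?case by (simp add: p)
  qed
  thus ?thesis by (rule abs_summable_summable)
qed

text \<open>
  Fubini for the absolutely summable double series: for fixed \<open>k\<close> the sum over \<open>n\<close> is a zeta value,
  for fixed \<open>n\<close> the sum over \<open>k\<close> is geometric and gives a term of the cotangent expansion.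
\<close>
lemma even_zeta_generating_function:
  fixes z :: complex
  assumes "z \<notin> \<int>" "norm z < 2"
  shows "(\<lambda>k. (zeta (of_nat (2 * Suc k)) - 1) * z ^ (2 * k + 1)) sums
           (1 / (2 * z) - of_real pi / 2 * cot (of_real pi * z) - z / (1 - z\<^sup>2))"
proof -
  define f :: "nat \<times> nat \<Rightarrow> complex"
    where "f = (\<lambda>(k, n). z ^ (2 * k + 1) / of_nat (n + 2) ^ (2 * Suc k))"
  obtain S where S: "(f has_sum S) (UNIV \<times> UNIV)"
    using even_zeta_double_series_summable[OF assms(2)] unfolding f_def summable_on_def by blast
  have "((\<lambda>n. f (k, n)) has_sum (zeta (of_nat (2 * Suc k)) - 1) * z ^ (2 * k + 1)) UNIV" for k
    using has_sum_cmult_left[OF zeta_nat_minus_1_has_sum[of "2 * Suc k"], of "z ^ (2 * k + 1)"]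
    by (simp add: f_def divide_inverse mult.commute del: of_nat_add)
  hence rows: "(\<lambda>k. (zeta (of_nat (2 * Suc k)) - 1) * z ^ (2 * k + 1)) sums S"
    by (intro has_sum_imp_sums has_sum_SigmaD[OF S])
  have "((\<lambda>k. f (k, n)) has_sum z / (of_nat (n + 2) ^ 2 - z\<^sup>2)) UNIV" for n
  proof -
    define a :: complex where "a = of_nat (n + 2)"
    have "norm a = real (n + 2)" unfolding a_def by (rule norm_of_nat)
    hence a: "norm a \<ge> 2" "a \<noteq> 0" by auto
    have q: "norm ((z / a)\<^sup>2) < 1"
      using assms(2) a by (simp add: norm_power norm_divide abs_square_less_1)
    have "a\<^sup>2 - z\<^sup>2 \<noteq> 0"
      using assms(2) a by (auto simp: power2_eq_iff)
    hence "z / a\<^sup>2 * (1 / (1 - (z / a)\<^sup>2)) = z / (a\<^sup>2 - z\<^sup>2)"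
      using a by (simp add: field_simps)
    moreover have "((\<lambda>k. z / a\<^sup>2 * ((z / a)\<^sup>2) ^ k) has_sum z / a\<^sup>2 * (1 / (1 - (z / a)\<^sup>2))) UNIV"
      using q by (intro has_sum_cmult_right norm_summable_imp_has_sum geometric_sums)
                 (auto simp: norm_power intro!: summable_geometric)
    moreover have "z / a\<^sup>2 * ((z / a)\<^sup>2) ^ k = f (k, n)" for k
      by (simp add: f_def a_def power_divide power_mult power2_eq_square del: of_nat_add)
    ultimately show ?thesis by (simp only: flip: a_def)
  qed
  hence "(\<lambda>n. z / (of_nat (n + 2) ^ 2 - z\<^sup>2)) sums S"
    by (intro has_sum_imp_sums has_sum_SigmaD[OF S[unfolded has_sum_swap[of f]]]) simp
  moreover have "(\<lambda>n. z / (of_nat (n + 2) ^ 2 - z\<^sup>2)) sums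
      (1 / (2 * z) - of_real pi / 2 * cot (of_real pi * z) - z / (1 - z\<^sup>2))"
    using cot_partial_fractions[OF assms(1)]
      sums_Suc_iff[of "\<lambda>n. z / (of_nat (Suc n) ^ 2 - z\<^sup>2)"
        "1 / (2 * z) - of_real pi / 2 * cot (of_real pi * z) - z / (1 - z\<^sup>2)"] by simp
  ultimately have "S = 1 / (2 * z) - of_real pi / 2 * cot (of_real pi * z) - z / (1 - z\<^sup>2)"
    by (rule sums_unique2)
  with rows show ?thesis by simp
qed

section \<open>Specialisation to the golden ratio\<close>

lemma lucas_number_closed_form:
  "real (lucas_number n) = ((1 + sqrt 5) / 2) ^ n + ((1 - sqrt 5) / 2) ^ n"
proof (induction n rule: lucas_number.induct)
  case (3 n)
  have "x ^ Suc (Suc n) = x ^ Suc n + x ^ n" if "x\<^sup>2 = x + 1" for x :: real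
  proof -
    have "x ^ Suc (Suc n) = x\<^sup>2 * x ^ n" by (simp add: power2_eq_square)
    thus ?thesis by (simp add: that algebra_simps)
  qed
  moreover have "((1 + sqrt 5) / 2)\<^sup>2 = (1 + sqrt 5) / 2 + 1" "((1 - sqrt 5) / 2)\<^sup>2 = (1 - sqrt 5) / 2 + 1"
    by (simp_all add: power2_eq_square field_simps)
  ultimately have "((1 + sqrt 5) / 2) ^ Suc (Suc n) = ((1 + sqrt 5) / 2) ^ Suc n + ((1 + sqrt 5) / 2) ^ n"
    "((1 - sqrt 5) / 2) ^ Suc (Suc n) = ((1 - sqrt 5) / 2) ^ Suc n + ((1 - sqrt 5) / 2) ^ n"
    by blast+
  with 3 show ?case by (simp only: lucas_number.simps of_nat_add)
qed (simp_all add: field_simps)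

text \<open>
  With \<open>x\<^sup>2 = x + 1\<close> one has \<open>1 / x = x - 1\<close> and \<open>1 - x\<^sup>2 = -x\<close>, so the rational part of the generating
  function is \<open>(x - 1) / 2 + 1 = x\<^sup>2 / 2\<close>. Stating this for any root treats \<open>\<phi>\<close> and its conjugate at
  once. The exponent on the left is \<open>(2k + 1) + m\<close>, so the truncated subtraction is harmless.
\<close>
lemma even_zeta_series_golden:
  fixes x :: real
  assumes x: "x\<^sup>2 = x + 1"
  shows "(\<lambda>k. (zeta (of_nat (2 * Suc k)) - 1) * of_real (x ^ (2 * Suc k + m - 1))) sums
           of_real (x ^ (m + 2) / 2 - pi / 2 * cot (pi * x) * x ^ m)"
proof -
  have nz: "complex_of_real x \<notin> \<int>"
  proof
    assume "complex_of_real x \<in> \<int>"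
    then obtain i where "complex_of_real x = of_int i" by (rule Ints_cases)
    hence "x = of_int i" by (metis of_real_eq_iff of_real_of_int_eq)
    with x have "i\<^sup>2 = i + 1" by (metis of_int_1 of_int_add of_int_eq_iff of_int_power)
    \<comment> \<open>A product of consecutive integers is even, so \<open>x\<close> cannot be an integer.\<close>
    hence "i * (i - 1) = 1" by (simp add: power2_eq_square algebra_simps)
    moreover have "even (i * (i - 1))" by simp
    ultimately show False by simp
  qed
  have "x < 2"
  proof (rule ccontr)
    assume "\<not> x < 2"
    hence "2 * x \<le> x\<^sup>2" by (simp add: power2_eq_square mult_right_mono)
    with x \<open>\<not> x < 2\<close> show False by simp
  qed
  moreover have "x > -2" using x zero_le_power2[of x] by linarith
  ultimately have "norm (of_real x :: complex) < 2" by simp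
  note * = even_zeta_generating_function[OF nz this]
  have eq: "1 / (2 * x) - c - x / (1 - x\<^sup>2) = x\<^sup>2 / 2 - c" for c
  proof -
    have "x \<noteq> 0" using x by auto
    have "x * (x - 1) = 1" using x by (simp add: power2_eq_square right_diff_distrib)
    hence "1 / x = x - 1" using \<open>x \<noteq> 0\<close> by (metis nonzero_mult_div_cancel_left)
    hence "1 / (2 * x) = (x - 1) / 2" by (metis divide_divide_eq_left mult.commute)
    moreover have "1 - x\<^sup>2 = -x" using x by linarith
    hence "x / (1 - x\<^sup>2) = -1" using \<open>x \<noteq> 0\<close> by simp
    ultimately show ?thesis using x by simp
  qed
  have "cot (complex_of_real pi * of_real x) = of_real (cot (pi * x))"
    by (simp add: cot_of_real)
  hence "1 / (2 * of_real x) - of_real pi / 2 * cot (of_real pi * of_real x)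
         - of_real x / (1 - (of_real x)\<^sup>2) = (of_real (x\<^sup>2 / 2 - pi / 2 * cot (pi * x)) :: complex)"
    unfolding eq[symmetric] by simp
  moreover have "(x\<^sup>2 / 2 - pi / 2 * cot (pi * x)) * x ^ m = x ^ (m + 2) / 2 - pi / 2 * cot (pi * x) * x ^ m"
    by (simp add: left_diff_distrib power2_eq_square)
  ultimately have limit: "(1 / (2 * of_real x) - of_real pi / 2 * cot (of_real pi * of_real x)
         - of_real x / (1 - (of_real x)\<^sup>2)) * of_real (x ^ m)
      = (of_real (x ^ (m + 2) / 2 - pi / 2 * cot (pi * x) * x ^ m) :: complex)"
    by (metis of_real_mult)
  have summand: "(zeta (of_nat (2 * Suc k)) - 1) * of_real x ^ (2 * k + 1) * of_real (x ^ m)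
      = (zeta (of_nat (2 * Suc k)) - 1) * of_real (x ^ (2 * Suc k + m - 1))" for k
  proof -
    have "2 * Suc k + m - 1 = (2 * k + 1) + m" by simp
    thus ?thesis
      by (simp only: power_add of_real_mult of_real_power mult.assoc)
  qed
  show ?thesis
    using sums_mult2[OF *, of "of_real (x ^ m)"] unfolding limit summand .
qed

theorem theorem2p2:
  fixes m :: nat
  shows "(\<lambda>k. (zeta (of_nat (2 * Suc k)) - 1) * of_nat (fib (2 * Suc k + m - 1))) sums
           complex_of_real (pi / (2 * sqrt 5) * tan (sqrt 5 * pi / 2) * real (lucas_number m)
             + 1 / 2 * real (fib (m + 2)))
       \<and> (\<lambda>k. (zeta (of_nat (2 * Suc k)) - 1) * of_nat (lucas_number (2 * Suc k + m - 1))) sums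
           complex_of_real (sqrt 5 * pi / 2 * tan (sqrt 5 * pi / 2) * real (fib m)
             + 1 / 2 * real (lucas_number (m + 2)))"
proof -
  define \<phi> :: real where "\<phi> = (1 + sqrt 5) / 2"
  define \<psi> :: real where "\<psi> = (1 - sqrt 5) / 2"
  define T where "T = tan (sqrt 5 * pi / 2)"
  have fib: "real (fib n) = (\<phi> ^ n - \<psi> ^ n) / sqrt 5" for n
    unfolding \<phi>_def \<psi>_def by (rule fib_closed_form)
  have lucas: "real (lucas_number n) = \<phi> ^ n + \<psi> ^ n" for n
    unfolding \<phi>_def \<psi>_def by (rule lucas_number_closed_form)
  have golden: "\<phi>\<^sup>2 = \<phi> + 1" "\<psi>\<^sup>2 = \<psi> + 1"
    by (simp_all add: \<phi>_def \<psi>_def power2_eq_square field_simps)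
  have "cot (pi / 2 + y) = - tan y" "cot (pi / 2 - y) = tan y" for y :: real
    by (simp_all add: cot_def tan_def sin_add cos_add sin_diff cos_diff)
  moreover have "pi * \<phi> = pi / 2 + sqrt 5 * pi / 2" "pi * \<psi> = pi / 2 - sqrt 5 * pi / 2"
    by (simp_all add: \<phi>_def \<psi>_def field_simps)
  ultimately have cot: "cot (pi * \<phi>) = -T" "cot (pi * \<psi>) = T"
    by (simp_all only: T_def)
  note \<phi> = even_zeta_series_golden[OF golden(1), of m, unfolded cot]
  note \<psi> = even_zeta_series_golden[OF golden(2), of m, unfolded cot]
  \<comment> \<open>An opaque \<open>s\<close> in place of \<open>\<surd>5\<close> makes this a purely rational identity, in which \<open>\<surd>5 * \<surd>5 = 5\<close>
      does not interfere with clearing denominators.\<close>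
  have "((\<phi> ^ (m + 2) / 2 - pi / 2 * (-T) * \<phi> ^ m) - (\<psi> ^ (m + 2) / 2 - pi / 2 * T * \<psi> ^ m)) / s
      = pi / (2 * s) * T * (\<phi> ^ m + \<psi> ^ m) + 1 / 2 * ((\<phi> ^ (m + 2) - \<psi> ^ (m + 2)) / s)"
    if "s \<noteq> 0" for s
    using that by (simp add: field_simps del: power_Suc)
  from this[of "sqrt 5"] have fib_value:
    "((\<phi> ^ (m + 2) / 2 - pi / 2 * (-T) * \<phi> ^ m) - (\<psi> ^ (m + 2) / 2 - pi / 2 * T * \<psi> ^ m)) / sqrt 5
      = pi / (2 * sqrt 5) * T * real (lucas_number m) + 1 / 2 * real (fib (m + 2))"
    unfolding fib lucas by simp
  have "(\<phi> ^ (m + 2) / 2 - pi / 2 * (-T) * \<phi> ^ m) + (\<psi> ^ (m + 2) / 2 - pi / 2 * T * \<psi> ^ m)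
      = s * pi / 2 * T * ((\<phi> ^ m - \<psi> ^ m) / s) + 1 / 2 * (\<phi> ^ (m + 2) + \<psi> ^ (m + 2))"
    if "s \<noteq> 0" for s
    using that by (simp add: field_simps del: power_Suc)
  from this[of "sqrt 5"] have lucas_value:
    "(\<phi> ^ (m + 2) / 2 - pi / 2 * (-T) * \<phi> ^ m) + (\<psi> ^ (m + 2) / 2 - pi / 2 * T * \<psi> ^ m)
      = sqrt 5 * pi / 2 * T * real (fib m) + 1 / 2 * real (lucas_number (m + 2))"
    unfolding fib lucas by simp
  have fib_complex: "(of_nat (fib n) :: complex) = (of_real (\<phi> ^ n) - of_real (\<psi> ^ n)) / of_real (sqrt 5)" for n
    using arg_cong[OF fib[of n], of complex_of_real] by simp
  have lucas_complex: "(of_nat (lucas_number n) :: complex) = of_real (\<phi> ^ n) + of_real (\<psi> ^ n)" for n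
    using arg_cong[OF lucas[of n], of complex_of_real] by simp
  show ?thesis
  proof
    from sums_divide[OF sums_diff[OF \<phi> \<psi>], of "of_real (sqrt 5)"]
    show "(\<lambda>k. (zeta (of_nat (2 * Suc k)) - 1) * of_nat (fib (2 * Suc k + m - 1))) sums
        complex_of_real (pi / (2 * sqrt 5) * tan (sqrt 5 * pi / 2) * real (lucas_number m)
          + 1 / 2 * real (fib (m + 2)))"
      unfolding T_def[symmetric] fib_value[symmetric] fib_complex
      by (simp only: of_real_diff of_real_divide right_diff_distrib times_divide_eq_right)
    from sums_add[OF \<phi> \<psi>]
    show "(\<lambda>k. (zeta (of_nat (2 * Suc k)) - 1) * of_nat (lucas_number (2 * Suc k + m - 1))) sums
        complex_of_real (sqrt 5 * pi / 2 * tan (sqrt 5 * pi / 2) * real (fib m)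
          + 1 / 2 * real (lucas_number (m + 2)))"
      unfolding T_def[symmetric] lucas_value[symmetric] lucas_complex
      by (simp only: of_real_add distrib_left)
  qed
qed

end
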